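(* Let $T$ be a truss. Suppose that $M \xrightarrow{i} E \xrightarrow{\pi} Q$ and $M \xrightarrow{i'} E' \xrightarrow{\pi'} Q'$ are short exact sequences of left $T$-modules, that $\mathrm{Abs}(Q')$ is not empty, and that $E$ and $E'$ are injective $T$-modules. Then there exists an isomorphism $E\times Q' \cong E'\times Q$ of $T$-modules. Thus, $Q$ is an injective $T$-module if and only if $Q'$ is an injective $T$-module.
   Context: A heap is a set $H$ with a ternary operation $[-,-,-]$ satisfying $[[a,b,c],d,e]=[a,b,[c,d,e]]$ and $[a,b,b]=a=[b,b,a]$; it is abelian if $[a,b,c]=[c,b,a]$. A truss is an abelian heap $T$ with an associative binary multiplication distributing over the heap operation on both sides: $w[x,y,z]=[wx,wy,wz]$ and $[x,y,z]w=[xw,yw,zw]$ (no identity is required). A left $T$-module is an abelian heap $M$ with an action $T\times M\to M$, $(t,m)\mapsto t\cdot m$, such that $t\cdot(t'\cdot m)=(tt')\cdot m$, $[t,t',t'']\cdot m=[t\cdot m,t'\cdot m,t''\cdot m]$ and $t\cdot[m,m',m'']=[t\cdot m,t\cdot m',t\cdot m'']$. The empty heap is allowed as a $T$-module (it is the initial object of the category of $T$-modules). Homomorphisms of $T$-modules ($T$-linear maps) preserve the heap operation and the action; monomorphisms of $T$-modules are exactly the injective ones. The product of two $T$-modules has componentwise heap operation and action. For a $T$-linear map $g:N\to P$ and $p\in \mathrm{Im}\,g$, $\ker_p g=\{n\in N : g(n)=p\}$. A short exact sequence of $T$-modules $M\xrightarrow{f} N\xrightarrow{g} P$ (written with dotted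 $\star\to M$ on the left and $P\to\star$ on the right) consists of non-empty $T$-modules and $T$-linear maps $f,g$ such that $f$ is injective, $g$ is surjective and there exists $p\in\mathrm{Im}\,g$ with $\mathrm{Im}\,f=\ker_p g$ as sets. $\mathrm{Abs}(M)=\{m\in M : t\cdot m=m \text{ for all } t\in T\}$ is the set of absorbers of $M$. A $T$-module $E$ is injective if for every monomorphism of $T$-modules $i:M\to N$ and every homomorphism of $T$-modules $f:M\to E$ there exists a homomorphism of $T$-modules $g:N\to E$ with $f=gi$. *)

theory Defs
  imports "HOL-Library.FuncSet" "HOL-Algebra.Congruence"
begin

text \<open>Heaps, trusses and modules are given by carriers, as in \<open>HOL-Algebra\<close>. Nothing forces a
  carrier to be non-empty, so the empty heap is a heap, and a module over every truss.\<close>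

record 'a heap = "'a partial_object" +
  tern :: "'a \<Rightarrow> 'a \<Rightarrow> 'a \<Rightarrow> 'a" (\<open>\<langle>_, _, _\<rangle>\<index>\<close>)

record 'a truss = "'a heap" +
  tmult :: "'a \<Rightarrow> 'a \<Rightarrow> 'a" (infixl \<open>\<odot>\<index>\<close> 70)

record ('t, 'm) tmodule = "'m heap" +
  act :: "'t \<Rightarrow> 'm \<Rightarrow> 'm" (infixr \<open>\<cdot>\<index>\<close> 75)

locale heap =
  fixes H (structure)
  assumes tern_closed [intro, simp]:
      "\<lbrakk>a \<in> carrier H; b \<in> carrier H; c \<in> carrier H\<rbrakk> \<Longrightarrow> \<langle>a, b, c\<rangle> \<in> carrier H"
    and tern_assoc:
      "\<lbrakk>a \<in> carrier H; b \<in> carrier H; c \<in> carrier H; d \<in> carrier H; e \<in> carrier H\<rbrakk>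
        \<Longrightarrow> \<langle>\<langle>a, b, c\<rangle>, d, e\<rangle> = \<langle>a, b, \<langle>c, d, e\<rangle>\<rangle>"
    and tern_cancel_right: "\<lbrakk>a \<in> carrier H; b \<in> carrier H\<rbrakk> \<Longrightarrow> \<langle>a, b, b\<rangle> = a"
    and tern_cancel_left: "\<lbrakk>a \<in> carrier H; b \<in> carrier H\<rbrakk> \<Longrightarrow> \<langle>b, b, a\<rangle> = a"

locale abelian_heap = heap +
  assumes tern_commute:
    "\<lbrakk>a \<in> carrier H; b \<in> carrier H; c \<in> carrier H\<rbrakk> \<Longrightarrow> \<langle>a, b, c\<rangle> = \<langle>c, b, a\<rangle>"

locale truss = abelian_heap T for T (structure) +
  assumes tmult_closed [intro, simp]:
      "\<lbrakk>x \<in> carrier T; y \<in> carrier T\<rbrakk> \<Longrightarrow> x \<odot> y \<in> carrier T"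
    and tmult_assoc:
      "\<lbrakk>x \<in> carrier T; y \<in> carrier T; z \<in> carrier T\<rbrakk> \<Longrightarrow> (x \<odot> y) \<odot> z = x \<odot> (y \<odot> z)"
    and tmult_distrib_left:
      "\<lbrakk>w \<in> carrier T; x \<in> carrier T; y \<in> carrier T; z \<in> carrier T\<rbrakk>
        \<Longrightarrow> w \<odot> \<langle>x, y, z\<rangle> = \<langle>w \<odot> x, w \<odot> y, w \<odot> z\<rangle>"
    and tmult_distrib_right:
      "\<lbrakk>w \<in> carrier T; x \<in> carrier T; y \<in> carrier T; z \<in> carrier T\<rbrakk>
        \<Longrightarrow> \<langle>x, y, z\<rangle> \<odot> w = \<langle>x \<odot> w, y \<odot> w, z \<odot> w\<rangle>"

locale tmodule = T: truss T + M: abelian_heap M for T (structure) and M (structure) +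
  assumes act_closed [intro, simp]:
      "\<lbrakk>t \<in> carrier T; m \<in> carrier M\<rbrakk> \<Longrightarrow> t \<cdot>\<^bsub>M\<^esub> m \<in> carrier M"
    and act_assoc:
      "\<lbrakk>t \<in> carrier T; t' \<in> carrier T; m \<in> carrier M\<rbrakk>
        \<Longrightarrow> t \<cdot>\<^bsub>M\<^esub> (t' \<cdot>\<^bsub>M\<^esub> m) = (t \<odot>\<^bsub>T\<^esub> t') \<cdot>\<^bsub>M\<^esub> m"
    and act_distrib_scalar:
      "\<lbrakk>t \<in> carrier T; t' \<in> carrier T; t'' \<in> carrier T; m \<in> carrier M\<rbrakk>
        \<Longrightarrow> \<langle>t, t', t''\<rangle>\<^bsub>T\<^esub> \<cdot>\<^bsub>M\<^esub> m = \<langle>t \<cdot>\<^bsub>M\<^esub> m, t' \<cdot>\<^bsub>M\<^esub> m, t'' \<cdot>\<^bsub>M\<^esub> m\<rangle>\<^bsub>M\<^esub>"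
    and act_distrib_module:
      "\<lbrakk>t \<in> carrier T; m \<in> carrier M; m' \<in> carrier M; m'' \<in> carrier M\<rbrakk>
        \<Longrightarrow> t \<cdot>\<^bsub>M\<^esub> \<langle>m, m', m''\<rangle>\<^bsub>M\<^esub> = \<langle>t \<cdot>\<^bsub>M\<^esub> m, t \<cdot>\<^bsub>M\<^esub> m', t \<cdot>\<^bsub>M\<^esub> m''\<rangle>\<^bsub>M\<^esub>"

definition tmod_hom :: "'t truss \<Rightarrow> ('t, 'm) tmodule \<Rightarrow> ('t, 'n) tmodule \<Rightarrow> ('m \<Rightarrow> 'n) set"
  where "tmod_hom T M N =
    {f \<in> carrier M \<rightarrow> carrier N.
      (\<forall>a\<in>carrier M. \<forall>b\<in>carrier M. \<forall>c\<in>carrier M.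
        f \<langle>a, b, c\<rangle>\<^bsub>M\<^esub> = \<langle>f a, f b, f c\<rangle>\<^bsub>N\<^esub>) \<and>
      (\<forall>t\<in>carrier T. \<forall>m\<in>carrier M. f (t \<cdot>\<^bsub>M\<^esub> m) = t \<cdot>\<^bsub>N\<^esub> f m)}"

definition tmod_iso :: "'t truss \<Rightarrow> ('t, 'm) tmodule \<Rightarrow> ('t, 'n) tmodule \<Rightarrow> ('m \<Rightarrow> 'n) set"
  where "tmod_iso T M N = {f \<in> tmod_hom T M N. bij_betw f (carrier M) (carrier N)}"

definition tmod_prod :: "('t, 'm) tmodule \<Rightarrow> ('t, 'n) tmodule \<Rightarrow> ('t, 'm \<times> 'n) tmodule"
  where "tmod_prod M N =
    \<lparr>carrier = carrier M \<times> carrier N,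
     tern = (\<lambda>(a, a') (b, b') (c, c'). (\<langle>a, b, c\<rangle>\<^bsub>M\<^esub>, \<langle>a', b', c'\<rangle>\<^bsub>N\<^esub>)),
     act = (\<lambda>t (m, n). (t \<cdot>\<^bsub>M\<^esub> m, t \<cdot>\<^bsub>N\<^esub> n))\<rparr>"

definition ker_at :: "('t, 'n) tmodule \<Rightarrow> ('n \<Rightarrow> 'p) \<Rightarrow> 'p \<Rightarrow> 'n set"
  where "ker_at N g p = {n \<in> carrier N. g n = p}"

definition short_exact ::
    "'t truss \<Rightarrow> ('t, 'm) tmodule \<Rightarrow> ('m \<Rightarrow> 'n) \<Rightarrow> ('t, 'n) tmodule \<Rightarrow> ('n \<Rightarrow> 'p) \<Rightarrow> ('t, 'p) tmodule \<Rightarrow> bool"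
  where "short_exact T M f N g P \<longleftrightarrow>
    tmodule T M \<and> tmodule T N \<and> tmodule T P \<and>
    carrier M \<noteq> {} \<and> carrier N \<noteq> {} \<and> carrier P \<noteq> {} \<and>
    f \<in> tmod_hom T M N \<and> g \<in> tmod_hom T N P \<and>
    inj_on f (carrier M) \<and> g ` carrier N = carrier P \<and>
    (\<exists>p \<in> g ` carrier N. f ` carrier M = ker_at N g p)"

definition absorbers :: "'t truss \<Rightarrow> ('t, 'm) tmodule \<Rightarrow> 'm set"
  where "absorbers T M = {m \<in> carrier M. \<forall>t\<in>carrier T. t \<cdot>\<^bsub>M\<^esub> m = m}"

text \<open>A formula cannot quantify over types, so injectivity carries the type \<open>'u\<close> of the elements of
  the test modules \<open>M\<close> and \<open>N\<close> as a parameter, unrelated to the type of the elements of \<open>E\<close>; a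
  module is injective if it is so for every \<open>'u\<close>. A theorem with an injectivity hypothesis
  lists the instances of it that it uses, possibly several. One type for both test modules is enough:
  \<open>M\<close> is isomorphic to its image in \<open>N\<close>. The monomorphisms are the injective homomorphisms.\<close>

definition injective_tmodule :: "'u itself \<Rightarrow> 't truss \<Rightarrow> ('t, 'e) tmodule \<Rightarrow> bool"
  where "injective_tmodule U T E \<longleftrightarrow>
    tmodule T E \<and>
    (\<forall>(M :: ('t, 'u) tmodule) (N :: ('t, 'u) tmodule) i f.
      tmodule T M \<and> tmodule T N \<and>
      i \<in> tmod_hom T M N \<and> inj_on i (carrier M) \<and> f \<in> tmod_hom T M E \<longrightarrow>
      (\<exists>g \<in> tmod_hom T N E. \<forall>m \<in> carrier M. f m = g (i m)))"

end

theory Submission imports Defs begin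

text \<open>As in Schanuel's lemma, both products are quotients of \<open>E \<times> E'\<close> by the same congruence, so that
  they are two descriptions of the pushout of \<open>i\<close> and \<open>i'\<close>. By injectivity there are
  \<open>\<alpha> : E \<rightarrow> E'\<close> and \<open>\<beta> : E' \<rightarrow> E\<close> with \<open>\<alpha> i = i'\<close> and \<open>\<beta> i' = i\<close>, and extending the map from the empty
  module along its inclusion into a point yields absorbers \<open>b\<close> of \<open>E\<close> and \<open>b'\<close> of \<open>E'\<close>, which serve as zeros:
  the quotient maps are \<open>(e, e') \<mapsto> (e - b + \<beta> e', \<pi>' e')\<close> and \<open>(e, e') \<mapsto> (\<alpha> e - b' + e', \<pi> e)\<close>,
  where \<open>x - y + z\<close> stands for the heap operation.\<close>

section \<open>Rearranging alternating sums in an abelian heap\<close>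

context abelian_heap
begin

text \<open>With the heap operation read as \<open>a - b + c\<close>, both sides are the same
  alternating sum with two negative entries exchanged. Reassociating and reversing a bracket by
  commutativity achieves the exchange. The lemmas below move entries of equal sign, or whole pairs,
  in the same way.\<close>

lemma tern_swap_middle:
  assumes "a \<in> carrier H" "b \<in> carrier H" "c \<in> carrier H" "d \<in> carrier H" "e \<in> carrier H"
  shows "\<langle>\<langle>a, b, c\<rangle>, d, e\<rangle> = \<langle>\<langle>a, d, c\<rangle>, b, e\<rangle>"
proof -
  have "\<langle>\<langle>a, b, c\<rangle>, d, e\<rangle> = \<langle>a, b, \<langle>e, d, c\<rangle>\<rangle>"
    using assms by (simp add: tern_assoc tern_commute[of c d e])
  also have "\<dots> = \<langle>c, d, \<langle>a, b, e\<rangle>\<rangle>"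
    using assms by (simp add: tern_assoc[symmetric] tern_commute[of "\<langle>a, b, e\<rangle>" d c])
  also have "\<dots> = \<langle>\<langle>a, d, c\<rangle>, b, e\<rangle>"
    using assms by (simp add: tern_assoc[symmetric] tern_commute[of c d a])
  finally show ?thesis .
qed

lemma tern_swap_right:
  assumes "a \<in> carrier H" "b \<in> carrier H" "c \<in> carrier H" "d \<in> carrier H" "e \<in> carrier H"
  shows "\<langle>\<langle>a, b, c\<rangle>, d, e\<rangle> = \<langle>\<langle>a, b, e\<rangle>, d, c\<rangle>"
  using assms by (simp add: tern_assoc tern_commute[of c d e])

lemma tern_middle:
  assumes "a \<in> carrier H" "b \<in> carrier H" "c \<in> carrier H" "d \<in> carrier H" "e \<in> carrier H"
  shows "\<langle>a, \<langle>b, c, d\<rangle>, e\<rangle> = \<langle>\<langle>a, d, c\<rangle>, b, e\<rangle>"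
proof -
  let ?p = "\<langle>b, c, d\<rangle>"
  \<comment> \<open>Adding \<open>?p\<close>, which is \<open>b - c + d\<close>, to
    \<open>a - d + c - b\<close> returns \<open>a\<close>. Once \<open>a\<close> is written in this
    form, the middle \<open>?p\<close> cancels against the one just added.\<close>
  have "\<langle>\<langle>a, d, c\<rangle>, b, ?p\<rangle> = a"
    using assms by (simp add: tern_assoc[of a d c] tern_assoc[symmetric, of c b b c d]
      tern_cancel_left tern_cancel_right)
  then have "\<langle>a, ?p, e\<rangle> = \<langle>\<langle>\<langle>a, d, c\<rangle>, b, ?p\<rangle>, ?p, e\<rangle>" by simp
  also have "\<dots> = \<langle>\<langle>a, d, c\<rangle>, b, e\<rangle>"
    using assms by (simp add: tern_assoc[of "\<langle>a, d, c\<rangle>" b ?p ?p e] tern_cancel_left)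
  finally show ?thesis .
qed

text \<open>The amount \<open>n - m\<close> is removed from one summand and added to the other. This
  identity is what lets an element coming from \<open>M\<close> pass between the two factors of
  \<open>E \<times> E'\<close> without changing the sum.\<close>

lemma tern_transfer:
  assumes "x \<in> carrier H" "n \<in> carrier H" "m \<in> carrier H" "b \<in> carrier H" "e \<in> carrier H"
  shows "\<langle>\<langle>x, n, m\<rangle>, b, \<langle>n, m, e\<rangle>\<rangle> = \<langle>x, b, e\<rangle>"
proof -
  have "\<langle>\<langle>x, n, m\<rangle>, b, \<langle>n, m, e\<rangle>\<rangle> = \<langle>\<langle>x, b, m\<rangle>, n, \<langle>n, m, e\<rangle>\<rangle>"
    using assms by (intro tern_swap_middle) auto
  also have "\<dots> = \<langle>x, b, \<langle>m, n, \<langle>n, m, e\<rangle>\<rangle>\<rangle>"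
    using assms by (simp add: tern_assoc)
  also have "\<langle>m, n, \<langle>n, m, e\<rangle>\<rangle> = e"
    using assms by (simp add: tern_assoc[symmetric, of m n n] tern_cancel_right tern_cancel_left)
  finally show ?thesis .
qed

lemma tern_right_cancel:
  assumes "x \<in> carrier H" "y \<in> carrier H" "b \<in> carrier H" "z \<in> carrier H" "\<langle>x, b, z\<rangle> = \<langle>y, b, z\<rangle>"
  shows "x = y"
proof -
  have "x = \<langle>\<langle>x, b, z\<rangle>, z, b\<rangle>" "y = \<langle>\<langle>y, b, z\<rangle>, z, b\<rangle>"
    using assms(1-4) by (simp_all add: tern_assoc tern_cancel_left tern_cancel_right)
  then show ?thesis using assms(5) by simp
qed

lemma tern_swap_pair:
  assumes "x \<in> carrier H" "b \<in> carrier H" "c \<in> carrier H" "d \<in> carrier H" "e \<in> carrier H"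
  shows "\<langle>\<langle>x, b, c\<rangle>, d, e\<rangle> = \<langle>\<langle>x, d, e\<rangle>, b, c\<rangle>"
  using assms by (simp only: tern_swap_middle[of x b c d e] tern_swap_right[of x d c b e])

text \<open>The interchange law, that is, additivity of the heap operation itself. It makes
  pointwise combinations of linear maps linear.\<close>

lemma tern_tern:
  assumes "a \<in> carrier H" "b \<in> carrier H" "c \<in> carrier H"
    and "a' \<in> carrier H" "b' \<in> carrier H" "c' \<in> carrier H"
    and "a'' \<in> carrier H" "b'' \<in> carrier H" "c'' \<in> carrier H"
  shows "\<langle>\<langle>a, b, c\<rangle>, \<langle>a', b', c'\<rangle>, \<langle>a'', b'', c''\<rangle>\<rangle> = \<langle>\<langle>a, a', a''\<rangle>, \<langle>b, b', b''\<rangle>, \<langle>c, c', c''\<rangle>\<rangle>"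
proof -
  \<comment> \<open>Opening the middle bracket gives one alternating sum nested to the left. Its
    pairs are then permuted until the entries can be regrouped by columns.\<close>
  have "\<langle>\<langle>a, b, c\<rangle>, \<langle>a', b', c'\<rangle>, \<langle>a'', b'', c''\<rangle>\<rangle> = \<langle>\<langle>\<langle>\<langle>a, b, c\<rangle>, c', b'\<rangle>, a', a''\<rangle>, b'', c''\<rangle>"
    using assms by (simp add: tern_middle[of "\<langle>a, b, c\<rangle>"] tern_assoc[symmetric, of _ _ a''])
  also have "\<langle>\<langle>\<langle>a, b, c\<rangle>, c', b'\<rangle>, a', a''\<rangle> = \<langle>\<langle>\<langle>a, b, c\<rangle>, a', a''\<rangle>, c', b'\<rangle>"
    using assms by (intro tern_swap_pair) auto
  also have "\<langle>\<langle>a, b, c\<rangle>, a', a''\<rangle> = \<langle>\<langle>a, a', a''\<rangle>, b, c\<rangle>"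
    using assms by (intro tern_swap_pair)
  also have "\<langle>\<langle>\<langle>\<langle>a, a', a''\<rangle>, b, c\<rangle>, c', b'\<rangle>, b'', c''\<rangle> = \<langle>\<langle>\<langle>\<langle>a, a', a''\<rangle>, b, c\<rangle>, b'', b'\<rangle>, c', c''\<rangle>"
    using assms by (intro tern_swap_middle) auto
  also have "\<langle>\<langle>\<langle>a, a', a''\<rangle>, b, c\<rangle>, b'', b'\<rangle> = \<langle>\<langle>\<langle>a, a', a''\<rangle>, b'', b'\<rangle>, b, c\<rangle>"
    using assms by (intro tern_swap_pair) auto
  also have "\<langle>\<langle>\<langle>\<langle>a, a', a''\<rangle>, b'', b'\<rangle>, b, c\<rangle>, c', c''\<rangle> = \<langle>\<langle>a, a', a''\<rangle>, \<langle>b, b', b''\<rangle>, \<langle>c, c', c''\<rangle>\<rangle>"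
    using assms by (simp add: tern_middle[of "\<langle>a, a', a''\<rangle>"] tern_assoc[of _ b c])
  finally show ?thesis .
qed

end

section \<open>Linear maps and their pointwise combinations\<close>

lemma tmod_homI:
  assumes "\<And>a. a \<in> carrier M \<Longrightarrow> f a \<in> carrier N"
    and "\<And>a b c. \<lbrakk>a \<in> carrier M; b \<in> carrier M; c \<in> carrier M\<rbrakk>
      \<Longrightarrow> f \<langle>a, b, c\<rangle>\<^bsub>M\<^esub> = \<langle>f a, f b, f c\<rangle>\<^bsub>N\<^esub>"
    and "\<And>t m. \<lbrakk>t \<in> carrier T; m \<in> carrier M\<rbrakk> \<Longrightarrow> f (t \<cdot>\<^bsub>M\<^esub> m) = t \<cdot>\<^bsub>N\<^esub> f m"
  shows "f \<in> tmod_hom T M N"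
  using assms by (auto simp: tmod_hom_def)

lemma tmod_homD:
  assumes "f \<in> tmod_hom T M N"
  shows "a \<in> carrier M \<Longrightarrow> f a \<in> carrier N"
    and "\<lbrakk>a \<in> carrier M; b \<in> carrier M; c \<in> carrier M\<rbrakk>
      \<Longrightarrow> f \<langle>a, b, c\<rangle>\<^bsub>M\<^esub> = \<langle>f a, f b, f c\<rangle>\<^bsub>N\<^esub>"
    and "\<lbrakk>t \<in> carrier T; a \<in> carrier M\<rbrakk> \<Longrightarrow> f (t \<cdot>\<^bsub>M\<^esub> a) = t \<cdot>\<^bsub>N\<^esub> f a"
  using assms by (auto simp: tmod_hom_def)

lemma tmod_hom_comp:
  assumes "f \<in> tmod_hom T M N" "g \<in> tmod_hom T N P"
  shows "(\<lambda>x. g (f x)) \<in> tmod_hom T M P"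
  using assms by (auto intro!: tmod_homI simp: tmod_homD)

lemma tmod_hom_const:
  assumes "tmodule T N" "b \<in> absorbers T N"
  shows "(\<lambda>_. b) \<in> tmod_hom T M N"
proof -
  interpret tmodule T N by fact
  show ?thesis using assms(2)
    by (auto intro!: tmod_homI simp: absorbers_def M.tern_cancel_left)
qed

text \<open>With \<open>g\<close> constant at an absorber this gives an addition of linear maps,
  which is how the two quotient maps are seen to be linear.\<close>

lemma tmod_hom_tern:
  assumes "tmodule T N" "f \<in> tmod_hom T M N" "g \<in> tmod_hom T M N" "h \<in> tmod_hom T M N"
  shows "(\<lambda>x. \<langle>f x, g x, h x\<rangle>\<^bsub>N\<^esub>) \<in> tmod_hom T M N"
proof -
  interpret tmodule T N by fact
  show ?thesis using assms(2-)
    by (auto intro!: tmod_homI M.tern_tern simp: tmod_homD act_distrib_module)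
qed

section \<open>Products of modules\<close>

lemma tmod_prod_simps [simp]:
  "carrier (tmod_prod M N) = carrier M \<times> carrier N"
  "\<langle>u, v, w\<rangle>\<^bsub>tmod_prod M N\<^esub> = (\<langle>fst u, fst v, fst w\<rangle>\<^bsub>M\<^esub>, \<langle>snd u, snd v, snd w\<rangle>\<^bsub>N\<^esub>)"
  "t \<cdot>\<^bsub>tmod_prod M N\<^esub> u = (t \<cdot>\<^bsub>M\<^esub> fst u, t \<cdot>\<^bsub>N\<^esub> snd u)"
  by (simp_all add: tmod_prod_def split_beta)

lemma tmodule_prod:
  assumes "tmodule T M" "tmodule T N"
  shows "tmodule T (tmod_prod M N)"
proof -
  interpret M: tmodule T M by fact
  interpret N: tmodule T N by fact
  show ?thesis
  proof unfold_locales
    fix a b c assume "a \<in> carrier (tmod_prod M N)" "b \<in> carrier (tmod_prod M N)"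
      "c \<in> carrier (tmod_prod M N)"
    then show "\<langle>a, b, c\<rangle>\<^bsub>tmod_prod M N\<^esub> = \<langle>c, b, a\<rangle>\<^bsub>tmod_prod M N\<^esub>"
      using M.M.tern_commute[of "fst a" "fst b" "fst c"] N.M.tern_commute[of "snd a" "snd b" "snd c"]
      by auto
  qed (auto simp: M.M.tern_assoc N.M.tern_assoc M.M.tern_cancel_left N.M.tern_cancel_left
      M.M.tern_cancel_right N.M.tern_cancel_right M.act_assoc N.act_assoc
      M.act_distrib_scalar N.act_distrib_scalar M.act_distrib_module N.act_distrib_module)
qed

lemma tmod_hom_fst: "fst \<in> tmod_hom T (tmod_prod M N) M"
  and tmod_hom_snd: "snd \<in> tmod_hom T (tmod_prod M N) N"
  by (auto intro!: tmod_homI)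

lemma tmod_hom_Pair:
  assumes "f \<in> tmod_hom T M N" "g \<in> tmod_hom T M P"
  shows "(\<lambda>x. (f x, g x)) \<in> tmod_hom T M (tmod_prod N P)"
  using assms by (auto intro!: tmod_homI simp: tmod_homD)

section \<open>Isomorphisms and common quotients\<close>

lemma tmod_iso_inv:
  assumes "tmodule T M" "h \<in> tmod_iso T M N"
  shows "inv_into (carrier M) h \<in> tmod_iso T N M"
proof -
  interpret tmodule T M by fact
  have h: "h \<in> tmod_hom T M N" and bij: "bij_betw h (carrier M) (carrier N)"
    using assms(2) by (auto simp: tmod_iso_def)
  let ?k = "inv_into (carrier M) h"
  have k: "?k x \<in> carrier M" "h (?k x) = x" if "x \<in> carrier N" for x
    using that bij by (auto simp: bij_betw_def inv_into_into f_inv_into_f)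
  have k_eq: "?k x = y" if "y \<in> carrier M" "h y = x" for x y
    using that bij by (auto simp: bij_betw_def)
  have "?k \<in> tmod_hom T N M"
    by (rule tmod_homI) (auto intro!: k_eq simp: k tmod_homD[OF h])
  then show ?thesis using bij_betw_inv_into[OF bij] by (simp add: tmod_iso_def)
qed

text \<open>A form of the first isomorphism theorem: \<open>A\<close> and \<open>B\<close> are both
  the quotient of \<open>F\<close> by the same congruence. One direction of \<open>fg\<close> makes
  the induced map well defined, the other makes it injective.\<close>

lemma tmod_iso_of_common_cover:
  assumes "tmodule T F" and f: "f \<in> tmod_hom T F A" and g: "g \<in> tmod_hom T F B"
    and sf: "f ` carrier F = carrier A" and sg: "g ` carrier F = carrier B"
    and fg: "\<And>u v. \<lbrakk>u \<in> carrier F; v \<in> carrier F\<rbrakk> \<Longrightarrow> f u = f v \<longleftrightarrow> g u = g v"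
  shows "\<exists>h. h \<in> tmod_iso T A B"
proof -
  interpret tmodule T F by fact
  define s where "s = inv_into (carrier F) f"
  have s: "s x \<in> carrier F" "f (s x) = x" if "x \<in> carrier A" for x
    using that sf by (auto simp: s_def inv_into_into f_inv_into_f)
  define h where "h x = g (s x)" for x
  \<comment> \<open>The section \<open>s\<close> is a mere choice of preimages and need not be
    linear. This fact frees \<open>h\<close> from the choice: any preimage computes it, so linearity
    is inherited from \<open>f\<close> and \<open>g\<close>.\<close>
  have h_eq: "h x = g u" if "u \<in> carrier F" "f u = x" for u x
  proof -
    have "x \<in> carrier A" using that sf by auto
    then show ?thesis using that fg[of "s x" u] by (simp add: h_def s)
  qed
  have "h \<in> tmod_hom T A B"
  proof (rule tmod_homI)
    fix a b c assume abc: "a \<in> carrier A" "b \<in> carrier A" "c \<in> carrier A"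
    have "h \<langle>a, b, c\<rangle>\<^bsub>A\<^esub> = g \<langle>s a, s b, s c\<rangle>\<^bsub>F\<^esub>"
      using abc by (intro h_eq) (simp_all add: s tmod_homD[OF f])
    then show "h \<langle>a, b, c\<rangle>\<^bsub>A\<^esub> = \<langle>h a, h b, h c\<rangle>\<^bsub>B\<^esub>"
      using abc by (simp add: h_def s tmod_homD[OF g])
  next
    fix t a assume ta: "t \<in> carrier T" "a \<in> carrier A"
    have "h (t \<cdot>\<^bsub>A\<^esub> a) = g (t \<cdot>\<^bsub>F\<^esub> s a)"
      using ta by (intro h_eq) (simp_all add: s tmod_homD[OF f])
    then show "h (t \<cdot>\<^bsub>A\<^esub> a) = t \<cdot>\<^bsub>B\<^esub> h a"
      using ta by (simp add: h_def s tmod_homD[OF g])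
  qed (simp add: h_def s tmod_homD[OF g])
  moreover have "bij_betw h (carrier A) (carrier B)"
    unfolding bij_betw_def
  proof
    show "inj_on h (carrier A)"
    proof (rule inj_onI)
      fix x y assume "x \<in> carrier A" "y \<in> carrier A" "h x = h y"
      then show "x = y" using fg[of "s x" "s y"] by (simp add: h_def s)
    qed
    have "h ` carrier A = h ` f ` carrier F" by (simp add: sf)
    also have "\<dots> = g ` carrier F" by (auto simp: image_image h_eq)
    finally show "h ` carrier A = carrier B" by (simp add: sg)
  qed
  ultimately show ?thesis by (auto simp: tmod_iso_def)
qed

section \<open>Injective modules, their absorbers and their retracts\<close>

lemma injective_tmoduleE:
  fixes M N :: "('t, 'u) tmodule"
  assumes "injective_tmodule TYPE('u) T E" "tmodule T M" "tmodule T N"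
    and "i \<in> tmod_hom T M N" "inj_on i (carrier M)" "f \<in> tmod_hom T M E"
  obtains g where "g \<in> tmod_hom T N E" "\<And>m. m \<in> carrier M \<Longrightarrow> g (i m) = f m"
proof -
  have "\<exists>g\<in>tmod_hom T N E. \<forall>m\<in>carrier M. f m = g (i m)"
    by (rule assms(1)[unfolded injective_tmodule_def, THEN conjunct2, rule_format])
      (intro conjI assms(2-))
  then obtain g where "g \<in> tmod_hom T N E" "\<forall>m\<in>carrier M. f m = g (i m)" ..
  then show ?thesis by (intro that) simp_all
qed

text \<open>Injectivity is tested on pairs of modules over one type, whereas \<open>M\<close> and
  \<open>N\<close> may live over different ones. So \<open>M\<close> is replaced by its image in
  \<open>N\<close>, and \<open>f\<close> by its composite with the inverse of \<open>i\<close> on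
  that image.\<close>

lemma injective_tmodule_extend:
  fixes M :: "('t, 'm) tmodule" and N :: "('t, 'n) tmodule"
  assumes E: "injective_tmodule TYPE('n) T E" and M: "tmodule T M" and N: "tmodule T N"
    and i: "i \<in> tmod_hom T M N" and inj: "inj_on i (carrier M)" and f: "f \<in> tmod_hom T M E"
  obtains g where "g \<in> tmod_hom T N E" "\<And>m. m \<in> carrier M \<Longrightarrow> g (i m) = f m"
proof -
  interpret M: tmodule T M by fact
  interpret N: tmodule T N by fact
  let ?I = "N\<lparr>carrier := i ` carrier M\<rparr>"
  have closed: "\<langle>i a, i b, i c\<rangle>\<^bsub>N\<^esub> \<in> i ` carrier M"
    if "a \<in> carrier M" "b \<in> carrier M" "c \<in> carrier M" for a b c
    using that by (auto simp: tmod_homD(2)[OF i, symmetric])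
  have closed_act: "t \<cdot>\<^bsub>N\<^esub> i a \<in> i ` carrier M" if "t \<in> carrier T" "a \<in> carrier M" for t a
    using that by (auto simp: tmod_homD(3)[OF i, symmetric])
  have I: "tmodule T ?I"
  proof unfold_locales
    fix a b c assume "a \<in> carrier ?I" "b \<in> carrier ?I" "c \<in> carrier ?I"
    then show "\<langle>a, b, c\<rangle>\<^bsub>?I\<^esub> = \<langle>c, b, a\<rangle>\<^bsub>?I\<^esub>"
      using N.M.tern_commute[of a b c] by (auto simp: tmod_homD[OF i])
  qed (auto simp: closed closed_act N.M.tern_assoc N.M.tern_cancel_left N.M.tern_cancel_right
      N.act_assoc N.act_distrib_scalar N.act_distrib_module tmod_homD(1)[OF i])
  let ?j = "inv_into (carrier M) i"
  have "i \<in> tmod_iso T M ?I"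
    using i inj by (auto simp: tmod_iso_def bij_betw_def tmod_hom_def)
  from tmod_iso_inv[OF M this] have j: "?j \<in> tmod_hom T ?I M"
    by (simp add: tmod_iso_def)
  have incl: "(\<lambda>x. x) \<in> tmod_hom T ?I N"
    by (rule tmod_homI) (auto simp: tmod_homD(1)[OF i])
  obtain g where g: "g \<in> tmod_hom T N E" "\<And>x. x \<in> carrier ?I \<Longrightarrow> g x = f (?j x)"
    using injective_tmoduleE[OF E I N incl _ tmod_hom_comp[OF j f]] by (auto simp: inj_on_def)
  then have "g (i m) = f m" if "m \<in> carrier M" for m
    using that inj by simp
  with g(1) show ?thesis by (rule that)
qed

lemma injective_tmodule_absorber:
  assumes "injective_tmodule TYPE('u) T E"
  obtains b where "b \<in> absorbers T E"
proof -
  have "tmodule T E" using assms by (simp add: injective_tmodule_def)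
  then interpret tmodule T E .
  \<comment> \<open>The one-point module; \<open>undefined\<close> serves as an arbitrary element of
    \<open>'u\<close>. Every scalar fixes the point, hence also its image under a linear
    map.\<close>
  let ?N = "\<lparr>carrier = {undefined :: 'u}, tern = \<lambda>_ _ _. undefined, act = \<lambda>_ _. undefined\<rparr>"
  let ?M = "?N\<lparr>carrier := {}\<rparr>"
  have M: "tmodule T ?M" and N: "tmodule T ?N"
    by unfold_locales auto
  \<comment> \<open>On the empty module \<open>?M\<close> any function is vacuously linear and
    injective, so injectivity yields a map out of the point.\<close>
  obtain g where "g \<in> tmod_hom T ?N E"
    using injective_tmoduleE[OF assms M N, of "\<lambda>x. x" "\<lambda>_. undefined"] by (auto simp: tmod_hom_def)
  then have "g undefined \<in> absorbers T E"
    by (auto simp: tmod_hom_def absorbers_def)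
  then show ?thesis by (rule that)
qed

text \<open>A map into \<open>B\<close> is pushed into \<open>A\<close> by \<open>s\<close>,
  extended there, and brought back by \<open>r\<close>.\<close>

lemma injective_tmodule_retract:
  fixes A :: "('t, 'a) tmodule" and B :: "('t, 'b) tmodule"
  assumes A: "injective_tmodule TYPE('u) T A" and B: "tmodule T B"
    and r: "r \<in> tmod_hom T A B" and s: "s \<in> tmod_hom T B A"
    and rs: "\<And>x. x \<in> carrier B \<Longrightarrow> r (s x) = x"
  shows "injective_tmodule TYPE('u) T B"
  unfolding injective_tmodule_def
proof (intro conjI allI impI B, elim conjE)
  fix M N :: "('t, 'u) tmodule" and i f
  assume h: "tmodule T M" "tmodule T N" "i \<in> tmod_hom T M N" "inj_on i (carrier M)"
    and f: "f \<in> tmod_hom T M B"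
  obtain g where g: "g \<in> tmod_hom T N A" "\<And>m. m \<in> carrier M \<Longrightarrow> g (i m) = s (f m)"
    using injective_tmoduleE[OF A h tmod_hom_comp[OF f s]] by auto
  then show "\<exists>g\<in>tmod_hom T N B. \<forall>m\<in>carrier M. f m = g (i m)"
    by (intro bexI[OF _ tmod_hom_comp[OF g(1) r]]) (simp add: rs tmod_homD[OF f])
qed

lemma injective_tmodule_prod:
  fixes A :: "('t, 'a) tmodule" and B :: "('t, 'b) tmodule"
  assumes A: "injective_tmodule TYPE('u) T A" and B: "injective_tmodule TYPE('u) T B"
  shows "injective_tmodule TYPE('u) T (tmod_prod A B)"
  unfolding injective_tmodule_def
proof (intro conjI allI impI, goal_cases)
  case 1
  show ?case using A B by (intro tmodule_prod) (simp_all add: injective_tmodule_def)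
next
  case (2 M N i f)
  then have h: "tmodule T M" "tmodule T N" "i \<in> tmod_hom T M N" "inj_on i (carrier M)"
    and f: "f \<in> tmod_hom T M (tmod_prod A B)" by auto
  obtain g where g: "g \<in> tmod_hom T N A" "\<And>m. m \<in> carrier M \<Longrightarrow> g (i m) = fst (f m)"
    using injective_tmoduleE[OF A h tmod_hom_comp[OF f tmod_hom_fst]] by auto
  obtain g' where g': "g' \<in> tmod_hom T N B" "\<And>m. m \<in> carrier M \<Longrightarrow> g' (i m) = snd (f m)"
    using injective_tmoduleE[OF B h tmod_hom_comp[OF f tmod_hom_snd]] by auto
  show ?case
    by (intro bexI[OF _ tmod_hom_Pair[OF g(1) g'(1)]]) (simp add: g(2) g'(2))
qed

lemma injective_tmodule_iso:
  assumes "injective_tmodule TYPE('u) T A" "tmodule T B" "h \<in> tmod_iso T A B"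
  shows "injective_tmodule TYPE('u) T B"
proof (rule injective_tmodule_retract[OF assms(1,2)])
  have A: "tmodule T A" using assms(1) by (simp add: injective_tmodule_def)
  show "h \<in> tmod_hom T A B" "inv_into (carrier A) h \<in> tmod_hom T B A"
    using assms(3) tmod_iso_inv[OF A assms(3)] by (simp_all add: tmod_iso_def)
  show "h (inv_into (carrier A) h x) = x" if "x \<in> carrier B" for x
    using assms(3) that by (simp add: tmod_iso_def bij_betw_def f_inv_into_f)
qed

text \<open>An absorber \<open>b\<close> of \<open>A\<close> makes the map sending \<open>x\<close>
  to \<open>(b, x)\<close> a linear section of \<open>snd\<close>, so \<open>B\<close> is a retract
  of the product.\<close>

lemma injective_tmodule_prod_right:
  assumes A: "tmodule T A" "absorbers T A \<noteq> {}" and B: "tmodule T B"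
    and P: "injective_tmodule TYPE('u) T (tmod_prod A B)"
  shows "injective_tmodule TYPE('u) T B"
proof -
  obtain b where b: "b \<in> absorbers T A" using A(2) by auto
  have "(\<lambda>x. x) \<in> tmod_hom T B B" by (auto intro: tmod_homI)
  then show ?thesis
    using injective_tmodule_retract[OF P B tmod_hom_snd
      tmod_hom_Pair[OF tmod_hom_const[OF A(1) b]]] by simp
qed

section \<open>Short exact sequences and the two quotient maps\<close>

lemma short_exact_fibre:
  assumes se: "short_exact T M i E \<pi> Q"
    and e: "e \<in> carrier E" "e' \<in> carrier E" "\<pi> e = \<pi> e'"
  obtains m n where "m \<in> carrier M" "n \<in> carrier M" "e' = \<langle>i n, i m, e\<rangle>\<^bsub>E\<^esub>"
proof -
  interpret E: tmodule T E using se by (simp add: short_exact_def)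
  interpret Q: tmodule T Q using se by (simp add: short_exact_def)
  have i: "i \<in> tmod_hom T M E" and \<pi>: "\<pi> \<in> tmod_hom T E Q" using se by (auto simp: short_exact_def)
  obtain p where p: "i ` carrier M = ker_at E \<pi> p" using se by (auto simp: short_exact_def)
  obtain m where m: "m \<in> carrier M" using se by (auto simp: short_exact_def)
  have im: "i m \<in> carrier E" "\<pi> (i m) = p" using m p by (auto simp: ker_at_def)
  \<comment> \<open>A heap has no distinguished zero, so the difference of \<open>e'\<close> and
    \<open>e\<close> is recorded by a pair of elements of \<open>M\<close>. The base point
    \<open>m\<close> is arbitrary; as \<pi> agrees on \<open>e\<close> and \<open>e'\<close>, the
    element \<open>e' - e + i m\<close> lies over \<open>p\<close> and so is \<open>i n\<close> for
    some \<open>n\<close>.\<close>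
  have "\<langle>e', e, i m\<rangle>\<^bsub>E\<^esub> \<in> ker_at E \<pi> p"
    using e im tmod_homD(1)[OF \<pi>, of e'] tmod_homD(1)[OF \<pi>, of "i m"]
    by (simp add: ker_at_def tmod_homD[OF \<pi>] Q.M.tern_cancel_left)
  then obtain n where n: "n \<in> carrier M" "i n = \<langle>e', e, i m\<rangle>\<^bsub>E\<^esub>" using p by force
  have "e' = \<langle>i n, i m, e\<rangle>\<^bsub>E\<^esub>"
    using e im by (simp add: n E.M.tern_assoc E.M.tern_cancel_left E.M.tern_cancel_right)
  with m n(1) show ?thesis by (rule that)
qed

lemma short_exact_comp_eq:
  assumes "short_exact T M i E \<pi> Q" "m \<in> carrier M" "n \<in> carrier M"
  shows "\<pi> (i m) = \<pi> (i n)"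
proof -
  obtain p where "i ` carrier M = ker_at E \<pi> p"
    using assms(1) by (auto simp: short_exact_def)
  then have "i m \<in> ker_at E \<pi> p" "i n \<in> ker_at E \<pi> p" using assms(2,3) by auto
  then show ?thesis by (simp add: ker_at_def)
qed

text \<open>One half of the comparison of the two congruences; the other half is the same lemma with
  the sequences exchanged. From \<open>\<pi>' x' = \<pi>' y'\<close>, the elements \<open>y'\<close>
  and \<open>x'\<close> differ by \<open>i' n - i' m\<close>, which \<beta> turns into
  \<open>i n - i m\<close>. The equality of sums then forces \<open>y = x - i n + i m\<close>. So
  \<open>(y, y')\<close> arises from \<open>(x, x')\<close> by moving \<open>n - m\<close> across
  the factors, which neither the sum formed with \<alpha> nor \<pi> detects.\<close>

lemma short_exact_congruence:
  assumes se: "short_exact T M i E \<pi> Q" and se': "short_exact T M i' E' \<pi>' Q'"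
    and \<alpha>: "\<alpha> \<in> tmod_hom T E E'" "\<And>m. m \<in> carrier M \<Longrightarrow> \<alpha> (i m) = i' m"
    and \<beta>: "\<beta> \<in> tmod_hom T E' E" "\<And>m. m \<in> carrier M \<Longrightarrow> \<beta> (i' m) = i m"
    and b: "b \<in> carrier E" "b' \<in> carrier E'"
    and x: "x \<in> carrier E" "x' \<in> carrier E'" and y: "y \<in> carrier E" "y' \<in> carrier E'"
    and eq: "\<langle>x, b, \<beta> x'\<rangle>\<^bsub>E\<^esub> = \<langle>y, b, \<beta> y'\<rangle>\<^bsub>E\<^esub>" "\<pi>' x' = \<pi>' y'"
  shows "\<langle>\<alpha> x, b', x'\<rangle>\<^bsub>E'\<^esub> = \<langle>\<alpha> y, b', y'\<rangle>\<^bsub>E'\<^esub>" "\<pi> x = \<pi> y"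
proof -
  interpret E: tmodule T E using se by (simp add: short_exact_def)
  interpret E': tmodule T E' using se' by (simp add: short_exact_def)
  interpret Q: tmodule T Q using se by (simp add: short_exact_def)
  have i: "i \<in> tmod_hom T M E" and \<pi>: "\<pi> \<in> tmod_hom T E Q"
    and i': "i' \<in> tmod_hom T M E'"
    using se se' by (auto simp: short_exact_def)
  obtain m n where mn: "m \<in> carrier M" "n \<in> carrier M" and y': "y' = \<langle>i' n, i' m, x'\<rangle>\<^bsub>E'\<^esub>"
    using short_exact_fibre[OF se' x(2) y(2) eq(2)] by blast
  note closed = x y(1) b mn tmod_homD(1)[OF i] tmod_homD(1)[OF i'] tmod_homD(1)[OF \<alpha>(1)]
    tmod_homD(1)[OF \<beta>(1)] tmod_homD(1)[OF \<pi>]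
  have \<beta>y': "\<beta> y' = \<langle>i n, i m, \<beta> x'\<rangle>\<^bsub>E\<^esub>"
    using closed by (simp add: y' tmod_homD(2)[OF \<beta>(1)] \<beta>(2))
  have "\<langle>\<langle>x, i n, i m\<rangle>\<^bsub>E\<^esub>, b, \<beta> y'\<rangle>\<^bsub>E\<^esub> = \<langle>y, b, \<beta> y'\<rangle>\<^bsub>E\<^esub>"
    using closed eq(1) by (simp only: \<beta>y' E.M.tern_transfer)
  then have y_eq: "y = \<langle>x, i n, i m\<rangle>\<^bsub>E\<^esub>"
    using E.M.tern_right_cancel[of "\<langle>x, i n, i m\<rangle>\<^bsub>E\<^esub>" y b "\<beta> y'"] closed y(2) by simp
  have "\<alpha> y = \<langle>\<alpha> x, i' n, i' m\<rangle>\<^bsub>E'\<^esub>"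
    using closed by (simp add: y_eq tmod_homD(2)[OF \<alpha>(1)] \<alpha>(2))
  then show "\<langle>\<alpha> x, b', x'\<rangle>\<^bsub>E'\<^esub> = \<langle>\<alpha> y, b', y'\<rangle>\<^bsub>E'\<^esub>"
    using closed by (simp add: y' E'.M.tern_transfer)
  show "\<pi> x = \<pi> y"
    using closed short_exact_comp_eq[OF se mn]
    by (simp add: y_eq tmod_homD(2)[OF \<pi>] Q.M.tern_cancel_right)
qed

lemma short_exact_cover:
  assumes E: "tmodule T E" and se': "short_exact T M i' E' \<pi>' Q'"
    and \<beta>: "\<beta> \<in> tmod_hom T E' E" and b: "b \<in> absorbers T E"
  defines "f \<equiv> \<lambda>u. (\<langle>fst u, b, \<beta> (snd u)\<rangle>\<^bsub>E\<^esub>, \<pi>' (snd u))"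
  shows "f \<in> tmod_hom T (tmod_prod E E') (tmod_prod E Q')"
    and "f ` (carrier E \<times> carrier E') = carrier E \<times> carrier Q'"
proof -
  interpret E: tmodule T E by fact
  have \<pi>': "\<pi>' \<in> tmod_hom T E' Q'" and surj: "\<pi>' ` carrier E' = carrier Q'"
    using se' by (auto simp: short_exact_def)
  show hom: "f \<in> tmod_hom T (tmod_prod E E') (tmod_prod E Q')"
    unfolding f_def
    by (intro tmod_hom_Pair tmod_hom_tern E tmod_hom_fst tmod_hom_const[OF E b]
        tmod_hom_comp[OF tmod_hom_snd \<beta>] tmod_hom_comp[OF tmod_hom_snd \<pi>'])
  have bE: "b \<in> carrier E" using b by (simp add: absorbers_def)
  have "(x, q) \<in> f ` (carrier E \<times> carrier E')" if "x \<in> carrier E" "q \<in> carrier Q'" for x q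
  proof -
    obtain e' where e': "e' \<in> carrier E'" "q = \<pi>' e'" using \<open>q \<in> carrier Q'\<close> surj by auto
    \<comment> \<open>The second coordinate is any lift \<open>e'\<close> of \<open>q\<close>; the
      first is then solved for as \<open>x - \<beta> e' + b\<close>.\<close>
    then have "f (\<langle>x, \<beta> e', b\<rangle>\<^bsub>E\<^esub>, e') = (x, q)"
      using \<open>x \<in> carrier E\<close> bE
      by (simp add: f_def tmod_homD(1)[OF \<beta>] E.M.tern_assoc E.M.tern_cancel_left E.M.tern_cancel_right)
    then show ?thesis
      using e' \<open>x \<in> carrier E\<close> bE
      by (intro image_eqI[where x = "(\<langle>x, \<beta> e', b\<rangle>\<^bsub>E\<^esub>, e')"]) (simp_all add: tmod_homD(1)[OF \<beta>])
  qed
  moreover have "f ` (carrier E \<times> carrier E') \<subseteq> carrier E \<times> carrier Q'"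
    using tmod_homD(1)[OF hom] by (simp add: image_subset_iff)
  ultimately show "f ` (carrier E \<times> carrier E') = carrier E \<times> carrier Q'" by auto
qed

section \<open>The isomorphism of the two products\<close>

lemma tmod_prod_swap: "prod.swap \<in> tmod_hom T (tmod_prod M N) (tmod_prod N M)"
  by (auto intro!: tmod_homI)

lemma schanuel_tmod_iso:
  assumes se: "short_exact T M i E \<pi> Q" and se': "short_exact T M i' E' \<pi>' Q'"
    and \<alpha>: "\<alpha> \<in> tmod_hom T E E'" "\<And>m. m \<in> carrier M \<Longrightarrow> \<alpha> (i m) = i' m"
    and \<beta>: "\<beta> \<in> tmod_hom T E' E" "\<And>m. m \<in> carrier M \<Longrightarrow> \<beta> (i' m) = i m"
    and b: "b \<in> absorbers T E" and b': "b' \<in> absorbers T E'"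
  shows "\<exists>h. h \<in> tmod_iso T (tmod_prod E Q') (tmod_prod E' Q)"
proof -
  have E: "tmodule T E" and E': "tmodule T E'" using se se' by (auto simp: short_exact_def)
  have bE: "b \<in> carrier E" "b' \<in> carrier E'" using b b' by (auto simp: absorbers_def)
  interpret E: tmodule T E by fact
  interpret E': tmodule T E' by fact
  let ?f = "\<lambda>u. (\<langle>fst u, b, \<beta> (snd u)\<rangle>\<^bsub>E\<^esub>, \<pi>' (snd u))"
  \<comment> \<open>This is \<open>?f\<close> with the two sequences exchanged, so its source is
    \<open>E' \<times> E\<close>. Composition with \<open>prod.swap\<close> gives it the same source
    as \<open>?f\<close>.\<close>
  let ?g = "\<lambda>u. (\<langle>fst u, b', \<alpha> (snd u)\<rangle>\<^bsub>E'\<^esub>, \<pi> (snd u))"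
  note f = short_exact_cover[OF E se' \<beta>(1) b]
  note g = short_exact_cover[OF E' se \<alpha>(1) b']
  show ?thesis
  proof (rule tmod_iso_of_common_cover)
    show "tmodule T (tmod_prod E E')" by (rule tmodule_prod[OF E E'])
    show "?f \<in> tmod_hom T (tmod_prod E E') (tmod_prod E Q')" by (rule f)
    show "(\<lambda>u. ?g (prod.swap u)) \<in> tmod_hom T (tmod_prod E E') (tmod_prod E' Q)"
      by (rule tmod_hom_comp[OF tmod_prod_swap g(1)])
    show "?f ` carrier (tmod_prod E E') = carrier (tmod_prod E Q')" using f(2) by simp
    have "(\<lambda>u. ?g (prod.swap u)) ` carrier (tmod_prod E E') = ?g ` prod.swap ` (carrier E \<times> carrier E')"
      by (simp only: image_image tmod_prod_simps)
    then show "(\<lambda>u. ?g (prod.swap u)) ` carrier (tmod_prod E E') = carrier (tmod_prod E' Q)"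
      using g(2) by (simp only: product_swap tmod_prod_simps)
  next
    fix u v assume "u \<in> carrier (tmod_prod E E')" "v \<in> carrier (tmod_prod E E')"
    then obtain x x' y y' where uv: "u = (x, x')" "v = (y, y')"
      and x: "x \<in> carrier E" "x' \<in> carrier E'" and y: "y \<in> carrier E" "y' \<in> carrier E'" by auto
    have \<alpha>\<beta>: "\<alpha> x \<in> carrier E'" "\<alpha> y \<in> carrier E'" "\<beta> x' \<in> carrier E" "\<beta> y' \<in> carrier E"
      using x y by (auto intro: tmod_homD(1)[OF \<alpha>(1)] tmod_homD(1)[OF \<beta>(1)])
    \<comment> \<open>In each half of the comparison the conclusion has its summands in the order
      opposite to that in \<open>?f\<close> or \<open>?g\<close>; these equations align
      them.\<close>
    have comm: "\<langle>\<beta> x', b, x\<rangle>\<^bsub>E\<^esub> = \<langle>x, b, \<beta> x'\<rangle>\<^bsub>E\<^esub>" "\<langle>\<beta> y', b, y\<rangle>\<^bsub>E\<^esub> = \<langle>y, b, \<beta> y'\<rangle>\<^bsub>E\<^esub>"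
      "\<langle>\<alpha> x, b', x'\<rangle>\<^bsub>E'\<^esub> = \<langle>x', b', \<alpha> x\<rangle>\<^bsub>E'\<^esub>" "\<langle>\<alpha> y, b', y'\<rangle>\<^bsub>E'\<^esub> = \<langle>y', b', \<alpha> y\<rangle>\<^bsub>E'\<^esub>"
      using x y bE \<alpha>\<beta> by (auto intro: E.M.tern_commute E'.M.tern_commute)
    note to_g = short_exact_congruence[OF se se' \<alpha> \<beta> bE x y, unfolded comm]
    note to_f = short_exact_congruence[OF se' se \<beta> \<alpha> bE(2,1) x(2,1) y(2,1), unfolded comm]
    show "?f u = ?f v \<longleftrightarrow> ?g (prod.swap u) = ?g (prod.swap v)"
      unfolding uv swap_simp fst_conv snd_conv prod.inject using to_f to_g by iprover
  qed
qed

theorem theorem4p26: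
  fixes T :: "'t truss"
    and M :: "('t, 'm) tmodule"
    and E :: "('t, 'e) tmodule" and Q :: "('t, 'q) tmodule"
    and E' :: "('t, 'e1) tmodule" and Q' :: "('t, 'q1) tmodule"
    and i :: "'m \<Rightarrow> 'e" and \<pi> :: "'e \<Rightarrow> 'q"
    and i' :: "'m \<Rightarrow> 'e1" and \<pi>' :: "'e1 \<Rightarrow> 'q1"
  assumes "truss T"
    and "short_exact T M i E \<pi> Q"
    and "short_exact T M i' E' \<pi>' Q'"
    and "absorbers T Q' \<noteq> {}"
    and "injective_tmodule TYPE('e1) T E" and "injective_tmodule TYPE('u) T E"
    and "injective_tmodule TYPE('e) T E'" and "injective_tmodule TYPE('u) T E'"
  shows "(\<exists>h. h \<in> tmod_iso T (tmod_prod E Q') (tmod_prod E' Q)) \<and>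
    (injective_tmodule TYPE('u) T Q \<longleftrightarrow> injective_tmodule TYPE('u) T Q')"
proof
  have M: "tmodule T M" and E: "tmodule T E" and E': "tmodule T E'"
    and Q: "tmodule T Q" and Q': "tmodule T Q'"
    and i: "i \<in> tmod_hom T M E" "inj_on i (carrier M)"
    and i': "i' \<in> tmod_hom T M E'" "inj_on i' (carrier M)"
    using assms(2,3) by (auto simp: short_exact_def)
  \<comment> \<open>The larger test module is \<open>E\<close>, so injectivity of \<open>E'\<close>
    is taken at the type \<open>'e\<close>; for \<beta> the roles are exchanged.\<close>
  obtain \<alpha> where \<alpha>: "\<alpha> \<in> tmod_hom T E E'" "\<And>m. m \<in> carrier M \<Longrightarrow> \<alpha> (i m) = i' m"
    using injective_tmodule_extend[OF assms(7) M E i i'(1)] by blast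
  obtain \<beta> where \<beta>: "\<beta> \<in> tmod_hom T E' E" "\<And>m. m \<in> carrier M \<Longrightarrow> \<beta> (i' m) = i m"
    using injective_tmodule_extend[OF assms(5) M E' i' i(1)] by blast
  obtain b b' where b: "b \<in> absorbers T E" and b': "b' \<in> absorbers T E'"
    using injective_tmodule_absorber[OF assms(6)] injective_tmodule_absorber[OF assms(8)] by metis
  show iso: "\<exists>h. h \<in> tmod_iso T (tmod_prod E Q') (tmod_prod E' Q)"
    by (rule schanuel_tmod_iso[OF assms(2,3) \<alpha> \<beta> b b'])
  then obtain h where h: "h \<in> tmod_iso T (tmod_prod E Q') (tmod_prod E' Q)" ..
  note EQ' = tmodule_prod[OF E Q'] and E'Q = tmodule_prod[OF E' Q]
  show "injective_tmodule TYPE('u) T Q \<longleftrightarrow> injective_tmodule TYPE('u) T Q'"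
  proof
    \<comment> \<open>Injectivity passes from \<open>E' \<times> Q\<close> to
      \<open>E \<times> Q'\<close> along the inverse of \<open>h\<close>, and the absorber
      \<open>b\<close> of \<open>E\<close> then splits off \<open>Q'\<close>. The converse uses
      \<open>h\<close> itself and \<open>b'\<close>.\<close>
    assume "injective_tmodule TYPE('u) T Q"
    from injective_tmodule_iso[OF injective_tmodule_prod[OF assms(8) this] EQ' tmod_iso_inv[OF EQ' h]]
    show "injective_tmodule TYPE('u) T Q'"
      using b by (intro injective_tmodule_prod_right[OF E _ Q']) auto
  next
    assume "injective_tmodule TYPE('u) T Q'"
    from injective_tmodule_iso[OF injective_tmodule_prod[OF assms(6) this] E'Q h]
    show "injective_tmodule TYPE('u) T Q"
      using b' by (intro injective_tmodule_prod_right[OF E' _ Q]) auto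
  qed
qed

end
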